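(* Let $f\colon\mathbb{R}^d\to\mathbb{R}$ be a differentiable convex function attaining its minimum value $f^\star$ at $x^\star$, and let $\overline{\nabla} f$ be a weak discrete gradient of $f$ with parameters $(\alpha,\beta,\gamma)$ such that $\beta\ge 0$ and $\gamma\ge 0$ (where $f$ satisfies whatever additional conditions are needed for $\overline{\nabla} f$ to be a weak discrete gradient with these parameters). Let $h>0$, let $A\colon\mathbb{R}_{\ge0}\to\mathbb{R}_{\ge0}$ be a differentiable strictly increasing function with $A(0)=0$, and put $A_k=A(kh)$ and $\delta^+A_k=\frac{A_{k+1}-A_k}{h}$ for $k\ge 0$. Let $x_0,v_0\in\mathbb{R}^d$ and let $\{(x^{(k)},v^{(k)})\}_{k\ge0}$ be the sequence in $\mathbb{R}^d\times\mathbb{R}^d$, with auxiliary points $z^{(k)}\in\mathbb{R}^d$, given by $(x^{(0)},v^{(0)})=(x_0,v_0)$ and $$A_k\,\frac{x^{(k+1)}-x^{(k)}}{h}=\delta^+A_k\left(v^{(k+1)}-x^{(k+1)}\right),$$ $$\frac{v^{(k+1)}-v^{(k)}}{h}=-\frac{\delta^+A_k}{4}\,\overline{\nabla} f\left(x^{(k+1)},z^{(k)}\right),$$ $$\frac{z^{(k)}-x^{(k)}}{h}=\frac{\delta^+A_k}{A_{k+1}}\left(v^{(k)}-x^{(k)}\right).$$ Then, if $A_k=(kh)^2$ and $h\le\frac{1}{\sqrt{2\alpha}}$, the sequence satisfies, for $k\ge 1$, $$f\left(x^{(k)}\right)-f^\star\le\frac{2\|x_0-x^\star\|^2}{A_k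}.$$
   Context: $\mathbb{R}^d$ carries the standard inner product $\langle\cdot,\cdot\rangle$ and the induced Euclidean norm $\|\cdot\|$. Weak discrete gradient: a map $\overline{\nabla} f\colon\mathbb{R}^d\times\mathbb{R}^d\to\mathbb{R}^d$ is a weak discrete gradient of $f$ with parameters $(\alpha,\beta,\gamma)$, where $\alpha\ge 0$ and $\beta,\gamma$ are real numbers with $\beta+\gamma\ge 0$, if for all $x,y,z\in\mathbb{R}^d$ $$f(y)-f(x)\le\langle\overline{\nabla} f(y,z),y-x\rangle+\alpha\|y-z\|^2-\beta\|z-x\|^2-\gamma\|y-x\|^2$$ and $\overline{\nabla} f(x,x)=\nabla f(x)$. When $\alpha=0$ the condition $h\le 1/\sqrt{2\alpha}$ is read as no restriction.
   Formalization: The printed bound with x_0 fails for unrelated x_0, v_0 (f(x)=x²/2, ∇̄f(y,z)=z, h=1, x_0=x*=0, v_0=1 gives f(x^(1))=9/32>0); proved instead is the bound with ‖v_0−x*‖² for arbitrary x_0, v_0, hence the printed one when v_0=x_0. *)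

theory Defs
  imports "HOL-Analysis.Analysis"
begin

definition weak_discrete_gradient ::
  "('a::real_inner \<Rightarrow> real) \<Rightarrow> ('a \<Rightarrow> 'a \<Rightarrow> 'a) \<Rightarrow> real \<Rightarrow> real \<Rightarrow> real \<Rightarrow> bool" where
  "weak_discrete_gradient f G \<alpha> \<beta> \<gamma> \<longleftrightarrow>
     \<alpha> \<ge> 0 \<and> \<beta> + \<gamma> \<ge> 0 \<and>
     (\<forall>x y z. f y - f x \<le> inner (G y z) (y - x) + \<alpha> * (norm (y - z))\<^sup>2
                - \<beta> * (norm (z - x))\<^sup>2 - \<gamma> * (norm (y - x))\<^sup>2) \<and>
     (\<forall>x. GDERIV f x :> G x x)"

definition grid :: "(real \<Rightarrow> real) \<Rightarrow> real \<Rightarrow> nat \<Rightarrow> real" where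
  "grid A h k = A (real k * h)"

definition fwd_diff :: "(real \<Rightarrow> real) \<Rightarrow> real \<Rightarrow> nat \<Rightarrow> real" where
  "fwd_diff A h k = (grid A h (k + 1) - grid A h k) / h"

text \<open>
  The first two equations are implicit in \<open>x (k + 1)\<close> and \<open>v (k + 1)\<close>, so the scheme is a
  predicate on the sequences; no existence or uniqueness of the iterates is presupposed.
  Since \<open>A 0 = 0\<close>, the equations for \<open>k = 0\<close> give \<open>v 1 = x 1\<close> and \<open>z 0 = v 0\<close>: the iterates
  with positive index depend on the initial data only through \<open>v 0\<close>.
\<close>

definition wdg_scheme ::
  "('a::real_inner \<Rightarrow> 'a \<Rightarrow> 'a) \<Rightarrow> (real \<Rightarrow> real) \<Rightarrow> real \<Rightarrow> 'a \<Rightarrow> 'a \<Rightarrow>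
   (nat \<Rightarrow> 'a) \<Rightarrow> (nat \<Rightarrow> 'a) \<Rightarrow> (nat \<Rightarrow> 'a) \<Rightarrow> bool" where
  "wdg_scheme G A h x0 v0 x v z \<longleftrightarrow>
     x 0 = x0 \<and> v 0 = v0 \<and>
     (\<forall>k. grid A h k *\<^sub>R ((x (k + 1) - x k) /\<^sub>R h)
            = fwd_diff A h k *\<^sub>R (v (k + 1) - x (k + 1))) \<and>
     (\<forall>k. (v (k + 1) - v k) /\<^sub>R h = - (fwd_diff A h k / 4) *\<^sub>R G (x (k + 1)) (z k)) \<and>
     (\<forall>k. (z k - x k) /\<^sub>R h = (fwd_diff A h k / grid A h (k + 1)) *\<^sub>R (v k - x k))"

end

theory Submission
  imports Defs
begin

text \<open>
  The energy \<open>A\<^sub>k (f x\<^sub>k - f\<^sup>\<star>) + 2 \<parallel>v\<^sub>k - x\<^sup>\<star>\<parallel>\<^sup>2\<close> does not increase along the scheme.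
  Weighting the weak discrete gradient inequalities at \<open>x\<^sub>k\<close> and \<open>x\<^sup>\<star>\<close> by \<open>A\<^sub>k\<close> and
  \<open>A\<^sub>k\<^sub>+\<^sub>1 - A\<^sub>k\<close> makes the inner products cancel against the change of the quadratic term.
  What remains is \<open>\<alpha> A\<^sub>k\<^sub>+\<^sub>1 \<parallel>x\<^sub>k\<^sub>+\<^sub>1 - z\<^sub>k\<parallel>\<^sup>2 - 2 \<parallel>v\<^sub>k\<^sub>+\<^sub>1 - v\<^sub>k\<parallel>\<^sup>2\<close>, and since
  \<open>A\<^sub>k\<^sub>+\<^sub>1 (x\<^sub>k\<^sub>+\<^sub>1 - z\<^sub>k) = (A\<^sub>k\<^sub>+\<^sub>1 - A\<^sub>k) (v\<^sub>k\<^sub>+\<^sub>1 - v\<^sub>k)\<close> this is nonpositive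
  as soon as \<open>\<alpha> (A\<^sub>k\<^sub>+\<^sub>1 - A\<^sub>k)\<^sup>2 \<le> 2 A\<^sub>k\<^sub>+\<^sub>1\<close>.
\<close>

lemma weak_discrete_gradient_upper:
  assumes "weak_discrete_gradient f G \<alpha> \<beta> \<gamma>" and "\<beta> \<ge> 0" and "\<gamma> \<ge> 0"
  shows "f y - f x \<le> inner (G y z) (y - x) + \<alpha> * (norm (y - z))\<^sup>2"
proof -
  have "f y - f x \<le> inner (G y z) (y - x) + \<alpha> * (norm (y - z))\<^sup>2
      - \<beta> * (norm (z - x))\<^sup>2 - \<gamma> * (norm (y - x))\<^sup>2"
    using assms(1) by (simp add: weak_discrete_gradient_def)
  moreover have "0 \<le> \<beta> * (norm (z - x))\<^sup>2" "0 \<le> \<gamma> * (norm (y - x))\<^sup>2"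
    using assms by simp_all
  ultimately show ?thesis by linarith
qed

text \<open>Here \<open>a\<close> and \<open>b\<close> stand for consecutive grid values, the scheme
  is cleared of its denominators, and \<open>p\<close> later becomes \<open>xstar\<close>.\<close>

lemma wdg_energy_step:
  fixes x x' v v' z p :: "'a::real_inner" and a b \<alpha> \<beta> \<gamma> :: real
  assumes wdg: "weak_discrete_gradient f G \<alpha> \<beta> \<gamma>" "\<beta> \<ge> 0" "\<gamma> \<ge> 0"
    and ab: "0 \<le> a" "a \<le> b" "0 < b"
    and x': "a *\<^sub>R (x' - x) = (b - a) *\<^sub>R (v' - x')"
    and v': "v' - v = - ((b - a) / 4) *\<^sub>R G x' z"
    and z: "b *\<^sub>R (z - x) = (b - a) *\<^sub>R (v - x)"
    and small: "\<alpha> * (b - a)\<^sup>2 \<le> 2 * b"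
  shows "b * (f x' - f p) + 2 * (norm (v' - p))\<^sup>2 \<le> a * (f x - f p) + 2 * (norm (v - p))\<^sup>2"
proof -
  define g where "g = G x' z"
  define r where "r = \<alpha> * (norm (x' - z))\<^sup>2"
  have "a * (f x' - f x) \<le> a * (inner g (x' - x) + r)"
    using weak_discrete_gradient_upper[OF wdg] ab unfolding g_def r_def
    by (intro mult_left_mono) auto
  moreover have "(b - a) * (f x' - f p) \<le> (b - a) * (inner g (x' - p) + r)"
    using weak_discrete_gradient_upper[OF wdg] ab unfolding g_def r_def
    by (intro mult_left_mono) auto
  \<comment> \<open>The \<open>x'\<close> equation trades \<open>a (x' - x)\<close> for
    \<open>(b - a) (v' - x')\<close>, so \<open>x'\<close> cancels.\<close>
  moreover have "a * inner g (x' - x) + (b - a) * inner g (x' - p) = (b - a) * inner g (v' - p)"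
  proof -
    have "a * inner g (x' - x) = (b - a) * inner g (v' - x')"
      using arg_cong[OF x', of "inner g"] by simp
    then show ?thesis by (simp add: inner_diff_right algebra_simps)
  qed
  ultimately have descent:
    "b * (f x' - f p) - a * (f x - f p) \<le> (b - a) * inner g (v' - p) + b * r"
    by (simp add: algebra_simps)

  \<comment> \<open>Expanding about \<open>v'\<close> gives the inner product of
    \<open>descent\<close>; the energy weight 2 and the factor 1/4 of the scheme combine as 2 * 2 /
    4 = 1, so the two cancel exactly.\<close>
  have "(norm (v - p))\<^sup>2 = (norm ((v' - p) - (v' - v)))\<^sup>2" by simp
  also have "\<dots> = (norm (v' - p))\<^sup>2 - 2 * inner (v' - v) (v' - p) + (norm (v' - v))\<^sup>2"
    unfolding power2_norm_eq_inner by (simp add: inner_diff inner_commute algebra_simps)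
  also have "inner (v' - v) (v' - p) = - ((b - a) / 4) * inner g (v' - p)"
    unfolding v' g_def by simp
  finally have quadratic:
    "2 * (norm (v' - p))\<^sup>2 - 2 * (norm (v - p))\<^sup>2
      = - ((b - a) * inner g (v' - p)) - 2 * (norm (v' - v))\<^sup>2"
    by simp

  \<comment> \<open>Adding \<open>(b - a) (x' - x)\<close> to the \<open>x'\<close> equation gives
    \<open>b (x' - x) = (b - a) (v' - x)\<close>; then subtract the \<open>z\<close>
    equation.\<close>
  have "b *\<^sub>R (x' - z) = (b - a) *\<^sub>R (v' - v)"
    using x' z by (simp add: algebra_simps) (metis add.commute add.left_commute add_right_cancel)
  then have "(norm (b *\<^sub>R (x' - z)))\<^sup>2 = (norm ((b - a) *\<^sub>R (v' - v)))\<^sup>2" by simp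
  then have "b\<^sup>2 * (norm (x' - z))\<^sup>2 = (b - a)\<^sup>2 * (norm (v' - v))\<^sup>2"
    by (simp add: power_mult_distrib)
  moreover have "b * (b * r) = \<alpha> * (b\<^sup>2 * (norm (x' - z))\<^sup>2)"
    by (simp add: r_def power2_eq_square)
  ultimately have "b * (b * r) = (\<alpha> * (b - a)\<^sup>2) * (norm (v' - v))\<^sup>2" by simp
  also have "\<dots> \<le> 2 * b * (norm (v' - v))\<^sup>2"
    using small by (intro mult_right_mono) auto
  finally have "b * (b * r) \<le> b * (2 * (norm (v' - v))\<^sup>2)" by simp
  then have "b * r \<le> 2 * (norm (v' - v))\<^sup>2"
    using ab by (simp add: mult_le_cancel_left_pos)
  with descent quadratic show ?thesis by linarith
qed

text \<open>The condition on \<open>h\<close> yields \<open>2 \<alpha> h^2 \<le> 1\<close>. It is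
  guarded by \<open>\<alpha> > 0\<close> because \<open>1 / sqrt 0 = 0\<close> would exclude every
  positive \<open>h\<close>.\<close>

lemma quadratic_grid_step_bound:
  fixes \<alpha> h :: real
  assumes "\<alpha> \<ge> 0" and "h > 0" and "\<alpha> > 0 \<Longrightarrow> h \<le> 1 / sqrt (2 * \<alpha>)"
  shows "\<alpha> * ((real (Suc k) * h)\<^sup>2 - (real k * h)\<^sup>2)\<^sup>2 \<le> 2 * (real (Suc k) * h)\<^sup>2"
proof -
  have step: "2 * (\<alpha> * h\<^sup>2) \<le> 1"
  proof (cases "\<alpha> > 0")
    case True
    then have "h * sqrt (2 * \<alpha>) \<le> 1" using assms(3) by (simp add: field_simps)
    then have "(h * sqrt (2 * \<alpha>))\<^sup>2 \<le> 1"
      using assms True by (intro power_le_one) auto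
    then show ?thesis using True by (simp add: power_mult_distrib mult_ac)
  qed (use assms in auto)
  have "((real (Suc k) * h)\<^sup>2 - (real k * h)\<^sup>2)\<^sup>2 = ((2 * real k + 1) * h\<^sup>2)\<^sup>2"
    by (simp add: power2_eq_square algebra_simps)
  \<comment> \<open>Rounding \<open>2 k + 1\<close> up to \<open>2 k + 2\<close> makes the square a
    multiple of the new grid value.\<close>
  also have "\<dots> \<le> ((2 * real (Suc k)) * h\<^sup>2)\<^sup>2"
    by (intro power_mono mult_right_mono) auto
  also have "\<dots> = 4 * h\<^sup>2 * (real (Suc k) * h)\<^sup>2"
    by (simp add: power2_eq_square algebra_simps)
  finally have "\<alpha> * ((real (Suc k) * h)\<^sup>2 - (real k * h)\<^sup>2)\<^sup>2
      \<le> \<alpha> * (4 * h\<^sup>2 * (real (Suc k) * h)\<^sup>2)"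
    using assms by (intro mult_left_mono) auto
  also have "\<dots> = 2 * (\<alpha> * h\<^sup>2) * (2 * (real (Suc k) * h)\<^sup>2)" by simp
  also have "\<dots> \<le> 1 * (2 * (real (Suc k) * h)\<^sup>2)"
    using step by (intro mult_right_mono) auto
  finally show ?thesis by simp
qed

text \<open>Since the grid starts at 0, the initial energy is
  \<open>2 * (norm (v0 - xstar))^2\<close>; hence the bound in \<open>v0\<close>, which takes the
  form in \<open>x0\<close> when the two agree.\<close>

theorem theorem3p6:
  fixes f :: "real ^ 'd \<Rightarrow> real"
    and G :: "real ^ 'd \<Rightarrow> real ^ 'd \<Rightarrow> real ^ 'd"
    and A :: "real \<Rightarrow> real"
    and x v z :: "nat \<Rightarrow> real ^ 'd"
    and x0 v0 xstar :: "real ^ 'd"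
    and fstar h \<alpha> \<beta> \<gamma> :: real
  assumes "f differentiable_on UNIV"
    and "convex_on UNIV f"
    and "f xstar = fstar" and "\<And>y. fstar \<le> f y"
    and "weak_discrete_gradient f G \<alpha> \<beta> \<gamma>" and "\<beta> \<ge> 0" and "\<gamma> \<ge> 0"
    and "h > 0"
    and "A \<in> {0..} \<rightarrow> {0..}" and "A differentiable_on {0..}"
    and "strict_mono_on {0..} A" and "A 0 = 0"
    and "wdg_scheme G A h x0 v0 x v z"
    and "\<And>k. grid A h k = (real k * h)\<^sup>2"
    and "\<alpha> > 0 \<Longrightarrow> h \<le> 1 / sqrt (2 * \<alpha>)"
  shows "\<forall>k\<ge>1. f (x k) - fstar \<le> 2 * (norm (v0 - xstar))\<^sup>2 / grid A h k \<and>
           (v0 = x0 \<longrightarrow> f (x k) - fstar \<le> 2 * (norm (x0 - xstar))\<^sup>2 / grid A h k)"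
proof -
  define a where "a k = (real k * h)\<^sup>2" for k
  have h: "h > 0" by fact
  have grid: "grid A h k = a k" for k using assms(14) by (simp add: a_def)
  have fwd: "h * fwd_diff A h k = a (Suc k) - a k" for k
    using h by (simp add: fwd_diff_def grid)
  \<comment> \<open>Positivity starts at index 1, as \<open>a 0 = 0\<close>; the divisors in the
    scheme and in the final bound have positive index.\<close>
  have a: "0 \<le> a k" "a k \<le> a (Suc k)" "0 < a (Suc k)" for k
    using h by (auto simp: a_def intro!: power_mono)
  have sch: "x 0 = x0" "v 0 = v0"
    "a k *\<^sub>R ((x (Suc k) - x k) /\<^sub>R h) = fwd_diff A h k *\<^sub>R (v (Suc k) - x (Suc k))"
    "(v (Suc k) - v k) /\<^sub>R h = - (fwd_diff A h k / 4) *\<^sub>R G (x (Suc k)) (z k)"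
    "(z k - x k) /\<^sub>R h = (fwd_diff A h k / a (Suc k)) *\<^sub>R (v k - x k)" for k
    using assms(13) unfolding wdg_scheme_def grid by auto
  have x_step: "a k *\<^sub>R (x (Suc k) - x k) = (a (Suc k) - a k) *\<^sub>R (v (Suc k) - x (Suc k))" for k
    using arg_cong[OF sch(3)[of k], of "scaleR h"] h unfolding fwd[symmetric]
    by (simp add: field_simps)
  have v_step: "v (Suc k) - v k = - ((a (Suc k) - a k) / 4) *\<^sub>R G (x (Suc k)) (z k)" for k
    using arg_cong[OF sch(4)[of k], of "scaleR h"] h unfolding fwd[symmetric] by simp
  have z_step: "a (Suc k) *\<^sub>R (z k - x k) = (a (Suc k) - a k) *\<^sub>R (v k - x k)" for k
    using arg_cong[OF sch(5)[of k], of "scaleR (a (Suc k) * h)"] h a(3)[of k]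
    unfolding fwd[symmetric] by (simp add: field_simps)
  have "\<alpha> \<ge> 0" using assms(5) by (simp add: weak_discrete_gradient_def)
  then have small: "\<alpha> * (a (Suc k) - a k)\<^sup>2 \<le> 2 * a (Suc k)" for k
    unfolding a_def using h assms(15) by (rule quadratic_grid_step_bound)
  define E where "E k = a k * (f (x k) - fstar) + 2 * (norm (v k - xstar))\<^sup>2" for k
  have "E (Suc k) \<le> E k" for k
    using wdg_energy_step[OF assms(5-7) a x_step v_step z_step small, where p = xstar]
    by (simp add: E_def assms(3))
  then have "E k \<le> E 0" for k using lift_Suc_antimono_le[of E 0 k] by simp
  moreover have "E 0 = 2 * (norm (v0 - xstar))\<^sup>2" by (simp add: E_def a_def sch)
  ultimately have E: "a k * (f (x k) - fstar) \<le> 2 * (norm (v0 - xstar))\<^sup>2" for k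
    unfolding E_def by (smt (verit) zero_le_power2)
  have "f (x k) - fstar \<le> 2 * (norm (v0 - xstar))\<^sup>2 / grid A h k" if "k \<ge> 1" for k
  proof -
    have "a k > 0" using that h by (simp add: a_def)
    then show ?thesis using E[of k] by (simp add: grid pos_le_divide_eq mult.commute)
  qed
  then show ?thesis by auto
qed

end
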